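(* Let $n=3^k$ for some integer $k\ge 1$. Then there is an odd cover of $K_n^{(3)}$ of size $(n-1)/2$.
   Context: $K_n^{(3)}$ denotes the collection of all $3$-element subsets of an $n$-element vertex set. A complete $3$-partite $3$-graph (on this vertex set) is specified by three pairwise disjoint sets $A_1,A_2,A_3$ of vertices, and consists of those $3$-sets that meet every $A_i$. The sets $A_1,A_2,A_3$ need not cover the vertex set. A set of complete $3$-partite $3$-graphs is an odd cover of $K_n^{(3)}$ if each $3$-set is in an odd number of these complete $3$-partite $3$-graphs. Its size is the number of complete $3$-partite $3$-graphs in it. *)

theory Defs
  imports Complex_Main "HOL-Library.Ramsey"
begin

text \<open>
  A \<open>3\<close>-graph on a vertex set \<open>V\<close> is a set of \<open>3\<close>-element subsets of \<open>V\<close>;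
  the complete one is \<open>nsets V 3\<close>. Complete \<open>3\<close>-partite \<open>3\<close>-graphs are identified with
  their edge sets, so permuting the three parts does not give a new one.
\<close>

definition tripartite_edges :: "'a set \<Rightarrow> 'a set \<Rightarrow> 'a set \<Rightarrow> 'a set \<Rightarrow> 'a set set" where
  "tripartite_edges V A\<^sub>1 A\<^sub>2 A\<^sub>3 =
     {e \<in> nsets V 3. e \<inter> A\<^sub>1 \<noteq> {} \<and> e \<inter> A\<^sub>2 \<noteq> {} \<and> e \<inter> A\<^sub>3 \<noteq> {}}"

definition complete_tripartite :: "'a set \<Rightarrow> 'a set set \<Rightarrow> bool" where
  "complete_tripartite V H \<longleftrightarrow>
     (\<exists>A\<^sub>1 A\<^sub>2 A\<^sub>3. A\<^sub>1 \<subseteq> V \<and> A\<^sub>2 \<subseteq> V \<and> A\<^sub>3 \<subseteq> V \<and>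
        A\<^sub>1 \<inter> A\<^sub>2 = {} \<and> A\<^sub>1 \<inter> A\<^sub>3 = {} \<and> A\<^sub>2 \<inter> A\<^sub>3 = {} \<and>
        H = tripartite_edges V A\<^sub>1 A\<^sub>2 A\<^sub>3)"

definition odd_cover :: "'a set \<Rightarrow> 'a set set set \<Rightarrow> bool" where
  "odd_cover V \<H> \<longleftrightarrow>
     (\<forall>H\<in>\<H>. complete_tripartite V H) \<and>
     (\<forall>e\<in>nsets V 3. odd (card {H \<in> \<H>. e \<in> H}))"

end

theory Submission
  imports Defs "HOL-Library.Numeral_Type" "HOL-Library.Function_Algebras"
    "HOL-Library.Disjoint_Sets" "HOL-Library.Z2"
begin

text \<open>
  Identify the vertex set with the vector space of dimension \<open>k\<close> over the field of three
  elements. Every nonzero \<open>a\<close> gives a complete tripartite hypergraph whose parts are the level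
  sets of the functional \<open>x \<mapsto> a \<bullet> x\<close>; it depends only on \<open>a\<close> up to sign, so there are
  \<open>(3\<^sup>k - 1) / 2\<close> of them. A triple \<open>{x, y, z}\<close> is an edge iff \<open>a \<bullet> w = 0\<close> and
  \<open>a \<bullet> u \<noteq> 0\<close>, where \<open>w = x + y + z\<close> and \<open>u = y - x\<close>, so choosing the sign of \<open>a\<close> the
  hypergraphs containing it correspond to the solutions \<open>a\<close> of \<open>a \<bullet> w = 0\<close>, \<open>a \<bullet> u = 1\<close>.
  A solution \<open>b\<close> exists because \<open>u\<close> is not a multiple of \<open>w\<close>, and the reflection
  \<open>a \<mapsto> - a - b\<close> of the solution set has \<open>b\<close> as its only fixed point. Hence the number of
  solutions is odd.
\<close>

section \<open>Arithmetic in the field of three elements\<close>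

lemma three_cases: "(x :: 3) = 0 \<or> x = 1 \<or> x = - 1"
proof -
  have "{0, 1, - 1 :: 3} = UNIV" by (rule card_subset_eq) auto
  then show ?thesis by auto
qed

lemma three_square: "(x :: 3) \<noteq> 0 \<Longrightarrow> x * x = 1"
  using three_cases[of x] by auto

lemma three_double: "(x :: 3) + x = - x"
  using three_cases[of x] by auto

text \<open>Three elements of this field sum to zero iff they are all equal or all distinct;
  \<open>q - p \<noteq> 0\<close> rules out the former.\<close>

lemma three_rainbow_iff:
  fixes p q r :: 3
  shows "0 \<in> {p, q, r} \<and> 1 \<in> {p, q, r} \<and> - 1 \<in> {p, q, r} \<longleftrightarrow> p + q + r = 0 \<and> q - p \<noteq> 0"
  using three_cases[of p] three_cases[of q] three_cases[of r] by (elim disjE) simp_all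

section \<open>Vectors and functionals over this field\<close>

definition vecs :: "nat \<Rightarrow> (nat \<Rightarrow> 3) set" where
  "vecs k = {f. \<forall>i\<ge>k. f i = 0}"

definition dot :: "nat \<Rightarrow> (nat \<Rightarrow> 3) \<Rightarrow> (nat \<Rightarrow> 3) \<Rightarrow> 3" where
  "dot k a x = (\<Sum>i<k. a i * x i)"

lemma vecs_closed [simp]:
  "0 \<in> vecs k"
  "x \<in> vecs k \<Longrightarrow> y \<in> vecs k \<Longrightarrow> x + y \<in> vecs k"
  "x \<in> vecs k \<Longrightarrow> y \<in> vecs k \<Longrightarrow> x - y \<in> vecs k"
  "x \<in> vecs k \<Longrightarrow> - x \<in> vecs k"
  by (auto simp: vecs_def)

lemma dot_commute: "dot k a x = dot k x a"
  by (simp add: dot_def mult.commute)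

lemma dot_simps [simp]:
  "dot k a 0 = 0"
  "dot k a (x + y) = dot k a x + dot k a y"
  "dot k a (x - y) = dot k a x - dot k a y"
  "dot k a (- x) = - dot k a x"
  "dot k 0 x = 0"
  "dot k (a + b) x = dot k a x + dot k b x"
  "dot k (a - b) x = dot k a x - dot k b x"
  "dot k (- a) x = - dot k a x"
  by (simp_all add: dot_def algebra_simps sum.distrib sum_subtractf sum_negf)

text \<open>Characteristic 3 turns \<open>x + x\<close> into \<open>- x\<close>.\<close>

lemma vec_eqI:
  fixes x y :: "nat \<Rightarrow> 3"
  assumes "x + x + y = 0"
  shows "x = y"
proof
  fix i
  have "x i + x i + y i = 0" using fun_cong[OF assms, of i] by simp
  then have "- x i + y i = 0" by (simp only: three_double)
  then show "x i = y i" by simp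
qed

lemma vec_uminus_neq: "a \<noteq> 0 \<Longrightarrow> - a \<noteq> (a :: nat \<Rightarrow> 3)"
  using vec_eqI[of a 0] by (metis add.left_inverse add.right_neutral)

lemma bij_betw_vecs_PiE:
  "bij_betw (\<lambda>f. restrict f {..<k}) (vecs k) ({..<k} \<rightarrow>\<^sub>E UNIV)"
  by (rule bij_betw_byWitness[where f' = "\<lambda>f i. if i < k then f i else 0"])
     (auto simp: vecs_def fun_eq_iff PiE_def extensional_def)

lemma finite_vecs [simp]: "finite (vecs k)"
  using bij_betw_finite[OF bij_betw_vecs_PiE] by (simp add: finite_PiE)

lemma card_vecs: "card (vecs k) = 3 ^ k"
  using bij_betw_same_card[OF bij_betw_vecs_PiE[of k]] by (simp add: card_PiE)

lemma dot_single:
  assumes "i < k"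
  shows "dot k (\<lambda>j. if j = i then c else 0) x = c * x i"
  using assms by (simp add: dot_def if_distrib[of "\<lambda>t. t * _"] cong: if_cong)

text \<open>The inequalities put \<open>u\<close> off the span \<open>{0, w, - w}\<close> of
  \<open>w\<close>, so some functional kills \<open>w\<close> but not \<open>u\<close>. This serves
  both the parity count and telling hypergraphs apart.\<close>

lemma exists_dot_0_1:
  assumes u: "u \<in> vecs k" and w: "w \<in> vecs k"
    and "u \<noteq> 0" "u \<noteq> w" "u \<noteq> - w"
  shows "\<exists>b\<in>vecs k. dot k b w = 0 \<and> dot k b u = 1"
proof (cases "w = 0")
  case True
  obtain i where i: "u i \<noteq> 0" using \<open>u \<noteq> 0\<close> by (auto simp: fun_eq_iff)
  then have ik: "i < k" using u by (auto simp: vecs_def not_le[symmetric])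
  let ?b = "\<lambda>j. if j = i then u i else 0"
  have "?b \<in> vecs k" using ik by (auto simp: vecs_def)
  moreover have "dot k ?b u = 1" using ik i by (simp add: dot_single three_square)
  ultimately show ?thesis using True by auto
next
  case False
  then obtain i where i: "w i \<noteq> 0" by (auto simp: fun_eq_iff)
  then have ik: "i < k" using w by (auto simp: vecs_def not_le[symmetric])
  \<comment> \<open>Since \<open>w i\<close> is its own inverse, \<open>u - c w\<close> vanishes at \<open>i\<close>; it is nonzero at some \<open>j\<close>,
    and the witness is supported on \<open>i\<close> and \<open>j\<close>.\<close>
  define c where "c = u i * w i"
  have "\<exists>j. u j \<noteq> c * w j"
    using three_cases[of c] assms(3-5) by (auto simp: fun_eq_iff)
  then obtain j where j: "u j \<noteq> c * w j" by blast
  then have jk: "j < k" using u w by (auto simp: vecs_def not_le[symmetric])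
  define d where "d = u j - c * w j"
  have dd: "d * d = 1" using j by (simp add: d_def three_square)
  \<comment> \<open>The coefficient at \<open>i\<close> cancels the contribution of \<open>j\<close>
    to the product with \<open>w\<close>; the product with \<open>u\<close> becomes
    \<open>d * (u j - c * w j)\<close>.\<close>
  let ?b = "(\<lambda>l. if l = j then d else 0) - (\<lambda>l. if l = i then d * w j * w i else 0)"
  have "?b \<in> vecs k" using ik jk by (auto simp: vecs_def)
  moreover have "dot k ?b w = d * w j - d * w j * (w i * w i)"
    using ik jk by (simp add: dot_single mult.assoc)
  then have "dot k ?b w = 0" using three_square[OF i] by simp
  moreover have "dot k ?b u = d * d"
    using ik jk by (simp add: dot_single d_def c_def algebra_simps)
  ultimately show ?thesis using dd by metis
qed

section \<open>Parity of the number of solutions\<close>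

lemma even_card_involution:
  assumes "\<And>x. x \<in> X \<Longrightarrow> h x \<in> X" "\<And>x. x \<in> X \<Longrightarrow> h (h x) = x" "\<And>x. x \<in> X \<Longrightarrow> h x \<noteq> x"
  shows "even (card X)"
proof -
  \<comment> \<open>Over the two-element field, \<open>x\<close> and \<open>h x\<close> together
    contribute 1 + 1 = 0.\<close>
  have "(\<Sum>x\<in>X. 1 :: bit) = 0"
    by (rule sum_involution_eq_0[where h = h]) (use assms in auto)
  then have "(of_nat (card X) :: bit) = 0" by simp
  then show ?thesis by (metis even_of_nat even_zero)
qed

lemma odd_card_solutions:
  assumes "u \<in> vecs k" "w \<in> vecs k" "u \<noteq> 0" "u \<noteq> w" "u \<noteq> - w"
  shows "odd (card {a \<in> vecs k. dot k a w = 0 \<and> dot k a u = 1})" (is "odd (card ?S)")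
proof -
  obtain b where b: "b \<in> ?S" using exists_dot_0_1[OF assms] by auto
  have "even (card (?S - {b}))"
  proof (rule even_card_involution[where h = "\<lambda>a. - a - b"])
    fix a assume a: "a \<in> ?S - {b}"
    show "- a - b \<noteq> a"
    proof
      assume "- a - b = a"
      then have "a + a + b = 0" by (simp add: algebra_simps)
      then show False using a vec_eqI by blast
    qed
    \<comment> \<open>The reflection must avoid the removed point: \<open>- a - b = b\<close> would
      force \<open>a = b\<close>.\<close>
    have "- a - b \<noteq> b"
    proof
      assume "- a - b = b"
      moreover have "b + b + a = b - (- a - b)" by (simp add: algebra_simps)
      ultimately have "b + b + a = 0" by simp
      then show False using a vec_eqI by blast
    qed
    then show "- a - b \<in> ?S - {b}" using a b by simp
    show "- (- a - b) - b = a" by simp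
  qed
  moreover have "card ?S = Suc (card (?S - {b}))"
    using b by (intro card.remove) auto
  ultimately show ?thesis by simp
qed

section \<open>The level-set hypergraphs and their cover\<close>

locale coordinates =
  fixes V :: "'a set" and k :: nat and \<phi> :: "'a \<Rightarrow> nat \<Rightarrow> 3"
  assumes bij: "bij_betw \<phi> V (vecs k)"
begin

definition level :: "(nat \<Rightarrow> 3) \<Rightarrow> 3 \<Rightarrow> 'a set" where
  "level a c = {v \<in> V. dot k a (\<phi> v) = c}"

definition graph :: "(nat \<Rightarrow> 3) \<Rightarrow> 'a set set" where
  "graph a = tripartite_edges V (level a 0) (level a 1) (level a (- 1))"

lemma complete_tripartite_graph: "complete_tripartite V (graph a)"
  unfolding complete_tripartite_def graph_def
  by (intro exI[of _ "level a 0"] exI[of _ "level a 1"] exI[of _ "level a (- 1)"])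
     (auto simp: level_def)

lemma coord_in_vecs: "v \<in> V \<Longrightarrow> \<phi> v \<in> vecs k"
  using bij by (auto simp: bij_betw_def)

lemma coord_eq_iff: "v \<in> V \<Longrightarrow> v' \<in> V \<Longrightarrow> \<phi> v = \<phi> v' \<longleftrightarrow> v = v'"
  using bij by (auto simp: bij_betw_def inj_on_def)

lemma graph_uminus: "graph (- a) = graph a"
proof -
  have "level (- a) c = level a (- c)" for c
    by (auto simp: level_def)
  then show ?thesis by (auto simp: graph_def tripartite_edges_def)
qed

lemma edge_iff:
  assumes "{x, y, z} \<in> nsets V 3"
  shows "{x, y, z} \<in> graph a \<longleftrightarrow>
    dot k a (\<phi> x + \<phi> y + \<phi> z) = 0 \<and> dot k a (\<phi> y - \<phi> x) \<noteq> 0"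
proof -
  have V: "x \<in> V" "y \<in> V" "z \<in> V" using assms by (auto simp: nsets_def)
  have *: "{x, y, z} \<inter> level a c \<noteq> {} \<longleftrightarrow>
      c \<in> {dot k a (\<phi> x), dot k a (\<phi> y), dot k a (\<phi> z)}" for c
    using V by (auto simp: level_def)
  show ?thesis
    using assms three_rainbow_iff[of "dot k a (\<phi> x)" "dot k a (\<phi> y)" "dot k a (\<phi> z)"]
    by (simp only: graph_def tripartite_edges_def mem_Collect_eq * dot_simps simp_thms)
qed

lemma graph_eq_iff:
  assumes a: "a \<in> vecs k" "a \<noteq> 0" and b: "b \<in> vecs k"
  shows "graph a = graph b \<longleftrightarrow> a = b \<or> a = - b"
proof (intro iffI)
  assume eq: "graph a = graph b"
  show "a = b \<or> a = - b"
  proof (rule ccontr)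
    assume "\<not> (a = b \<or> a = - b)"
    \<comment> \<open>The triple with coordinates \<open>0\<close>, \<open>y\<close>,
      \<open>- y\<close> sums to zero; it is an edge for \<open>a\<close>, which separates its
      points, but not for \<open>b\<close>, which vanishes on all of them.\<close>
    then obtain y where y: "y \<in> vecs k" "dot k y b = 0" "dot k y a = 1"
      using exists_dot_0_1[of a k b] a b by auto
    have "\<exists>v\<in>V. \<phi> v = x" if "x \<in> vecs k" for x
      using bij that by (force simp: bij_betw_def)
    then obtain p q r where pqr: "p \<in> V" "q \<in> V" "r \<in> V" "\<phi> p = 0" "\<phi> q = y" "\<phi> r = - y"
      using y(1) by (metis vecs_closed(1,4))
    have "dot k a (\<phi> p) = 0" "dot k a (\<phi> q) = 1" "dot k a (\<phi> r) = - 1"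
      using pqr y by (simp_all add: dot_commute[of k a])
    then have "p \<noteq> q" "p \<noteq> r" "q \<noteq> r" by auto
    then have e: "{p, q, r} \<in> nsets V 3" using pqr by (auto simp: nsets_def)
    show False
      using edge_iff[OF e, of a] edge_iff[OF e, of b] eq pqr y
      by (simp add: dot_commute[of k a] dot_commute[of k b])
  qed
qed (auto simp: graph_uminus)

definition cover :: "'a set set set" where
  "cover = graph ` (vecs k - {0})"

text \<open>The fibres of \<open>graph\<close> on the nonzero vectors are the two-element sets
  \<open>{a, - a}\<close>.\<close>

lemma card_cover: "3 ^ k - 1 = 2 * card cover"
proof -
  let ?A = "vecs k - {0}"
  have "card ?A = (\<Sum>H\<in>cover. card {a \<in> ?A. graph a = H})"
    using sum.image_gen[of ?A "\<lambda>_. 1 :: nat" graph] by (simp add: cover_def)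
  also have "\<dots> = (\<Sum>H\<in>cover. 2)"
  proof (rule sum.cong)
    fix H assume "H \<in> cover"
    then obtain a where a: "a \<in> ?A" "H = graph a" by (auto simp: cover_def)
    then have "{b \<in> ?A. graph b = H} = {a, - a}"
      using graph_eq_iff[of _ a] by (auto simp: graph_uminus)
    then show "card {b \<in> ?A. graph b = H} = 2"
      using vec_uminus_neq[of a] a by (auto simp: card_insert_if)
  qed simp
  finally show ?thesis by (simp add: card_vecs)
qed

lemma odd_card_containing:
  assumes "e \<in> nsets V 3"
  shows "odd (card {H \<in> cover. e \<in> H})"
proof -
  obtain x y z where e: "e = {x, y, z}" and ne: "x \<noteq> y" "x \<noteq> z" "y \<noteq> z"
    and V: "x \<in> V" "y \<in> V" "z \<in> V"
    using assms by (auto simp: nsets_3_eq)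
  define w where "w = \<phi> x + \<phi> y + \<phi> z"
  define u where "u = \<phi> y - \<phi> x"
  let ?S = "{a \<in> vecs k. dot k a w = 0 \<and> dot k a u = 1}"
  have edge: "e \<in> graph a \<longleftrightarrow> dot k a w = 0 \<and> dot k a u \<noteq> 0" for a
    using edge_iff assms unfolding e w_def u_def by blast
  have "odd (card ?S)"
  \<comment> \<open>The inequalities for \<open>u\<close> against \<open>0\<close>, \<open>w\<close>
    and \<open>- w\<close> encode \<open>x \<noteq> y\<close>, \<open>x \<noteq> z\<close> and
    \<open>y \<noteq> z\<close> respectively.\<close>
  proof (rule odd_card_solutions)
    show "u \<in> vecs k" "w \<in> vecs k" using V by (simp_all add: u_def w_def coord_in_vecs)
    show "u \<noteq> 0" using V ne by (simp add: u_def coord_eq_iff)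
    show "u \<noteq> w"
    proof
      assume "u = w"
      then have "\<phi> x + \<phi> x + \<phi> z = 0" by (simp add: u_def w_def algebra_simps)
      then show False using V ne vec_eqI coord_eq_iff by blast
    qed
    show "u \<noteq> - w"
    proof
      assume "u = - w"
      then have "\<phi> y + \<phi> y + \<phi> z = 0" by (simp add: u_def w_def algebra_simps)
      then show False using V ne vec_eqI coord_eq_iff by blast
    qed
  qed
  \<comment> \<open>Requiring \<open>dot k a u = 1\<close> selects exactly one of \<open>a\<close>
    and \<open>- a\<close> for each hypergraph containing \<open>e\<close>.\<close>
  also have "card ?S = card (graph ` ?S)"
  proof (rule card_image[symmetric], rule inj_onI)
    fix a b assume ab: "a \<in> ?S" "b \<in> ?S" "graph a = graph b"
    then have "a \<noteq> 0" "a \<noteq> - b" by auto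
    then show "a = b" using ab graph_eq_iff[of a b] by auto
  qed
  also have "graph ` ?S = {H \<in> cover. e \<in> H}"
  proof (intro equalityI subsetI)
    fix H assume "H \<in> graph ` ?S"
    then obtain a where a: "a \<in> ?S" "H = graph a" by blast
    then have "a \<noteq> 0" by auto
    then show "H \<in> {H \<in> cover. e \<in> H}" using a edge[of a] by (auto simp: cover_def)
  next
    fix H assume "H \<in> {H \<in> cover. e \<in> H}"
    then obtain a where a: "a \<in> vecs k" "H = graph a" "e \<in> graph a" by (auto simp: cover_def)
    then have "a \<in> ?S \<or> - a \<in> ?S"
      using edge[of a] three_cases[of "dot k a u"] by auto
    then show "H \<in> graph ` ?S" using a(2) graph_uminus[of a] by blast
  qed
  finally show ?thesis .
qed

lemma odd_cover_cover: "odd_cover V cover"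
  using odd_card_containing complete_tripartite_graph
  by (auto simp: odd_cover_def cover_def)

end

theorem theorem3:
  fixes V :: "'a set" and n k :: nat
  assumes "k \<ge> 1" and "n = 3 ^ k" and "finite V" and "card V = n"
  shows "\<exists>\<H>. odd_cover V \<H> \<and> real (card \<H>) = (real n - 1) / 2"
proof -
  obtain \<phi> where "bij_betw \<phi> V (vecs k)"
    using finite_same_card_bij[of V "vecs k"] assms by (auto simp: card_vecs)
  then interpret coordinates V k \<phi> by unfold_locales
  have "n = 2 * card cover + 1"
    using card_cover assms(2) by (simp add: algebra_simps flip: card_cover)
  then have "real (card cover) = (real n - 1) / 2" by simp
  then show ?thesis using odd_cover_cover by blast
qed

end
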